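(* Let $Q_n$ be the $n$-cube. Then, for all $n\geq 2$, $mc^{nh}_{2^n}(Q_n)\geq 2^{n-2}$.
   Context: All graphs are simple and finite. The $n$-cube $Q_n$ is defined inductively: $Q_1$ is the path $P_2$ on two vertices, and $Q_n$ is constructed from the disjoint union of two copies of $Q_{n-1}$ by adding an edge from each vertex in one copy to the corresponding vertex in the other copy; it has $2^n$ vertices. For a graph $G$ with $N$ vertices, a no-hole anti-$N$-labeling of $G$ is a map $\psi:V(G)\to\{1,2,\ldots,N\}$ that uses all labels between $1$ and $N$ (hence a bijection). For an edge $e=uv$ put $w^{nh}_\psi(e)=|\psi(u)-\psi(v)|$, and let $w^{nh}_\psi(G)=\min\{w^{nh}_\psi(e): e\in E(G)\}$. The no-hole anti-$N$-labeling number of $G$ is $mc^{nh}_N(G)=\max_\psi w^{nh}_\psi(G)$, the maximum being over all no-hole anti-$N$-labelings $\psi$ of $G$. *)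

theory Defs
  imports "Graph_Theory.Pair_Digraph"
begin

text \<open>
  A simple finite graph is a symmetric loop-free finite digraph without parallel arcs, i.e.\ an
  instance of the locale \<^locale>\<open>pair_graph\<close>; an edge \<open>uv\<close> is represented by the two arcs
  \<open>(u, v)\<close> and \<open>(v, u)\<close>.
\<close>

definition path2 :: "bool list pair_pre_digraph" where
  "path2 = \<lparr> pverts = {[False], [True]},
             parcs = {([False], [True]), ([True], [False])} \<rparr>"

text \<open>The vertex \<open>v\<close> of \<open>G\<close> becomes \<open>False # v\<close> in one copy and \<open>True # v\<close> in the other.\<close>

definition double_graph :: "bool list pair_pre_digraph \<Rightarrow> bool list pair_pre_digraph" where
  "double_graph G =
     \<lparr> pverts = {b # v |b v. v \<in> pverts G},
       parcs = {(b # u, b # v) |b u v. (u, v) \<in> parcs G}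
               \<union> {(b # v, (\<not> b) # v) |b v. v \<in> pverts G} \<rparr>"

text \<open>The value at \<open>0\<close> is a convention: the single vertex, whose double is \<^const>\<open>path2\<close>.\<close>

fun cube :: "nat \<Rightarrow> bool list pair_pre_digraph" where
  "cube 0 = \<lparr> pverts = {[]}, parcs = {} \<rparr>"
| "cube (Suc 0) = path2"
| "cube (Suc (Suc n)) = double_graph (cube (Suc n))"

definition no_hole_labeling :: "nat \<Rightarrow> 'a pair_pre_digraph \<Rightarrow> ('a \<Rightarrow> nat) \<Rightarrow> bool" where
  "no_hole_labeling N G \<psi> \<longleftrightarrow> \<psi> ` pverts G = {1..N}"

definition edge_weight :: "('a \<Rightarrow> nat) \<Rightarrow> 'a \<times> 'a \<Rightarrow> nat" where
  "edge_weight \<psi> e = nat \<bar>int (\<psi> (fst e)) - int (\<psi> (snd e))\<bar>"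

text \<open>Only meaningful if \<open>G\<close> has an edge.\<close>

definition min_edge_weight :: "'a pair_pre_digraph \<Rightarrow> ('a \<Rightarrow> nat) \<Rightarrow> nat" where
  "min_edge_weight G \<psi> = Min (edge_weight \<psi> ` parcs G)"

text \<open>Intended for graphs with exactly \<open>N\<close> vertices, where the labelings are bijections.\<close>

definition mc_nh :: "nat \<Rightarrow> 'a pair_pre_digraph \<Rightarrow> nat" where
  "mc_nh N G = Max {min_edge_weight G \<psi> |\<psi>. no_hole_labeling N G \<psi>}"

lemma no_hole_labeling_iff_bij_betw:
  assumes "finite (pverts G)" "card (pverts G) = N"
  shows "no_hole_labeling N G \<psi> \<longleftrightarrow> bij_betw \<psi> (pverts G) {1..N}"
  using assms by (auto simp: no_hole_labeling_def bij_betw_def intro!: eq_card_imp_inj_on)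

lemma cube_Suc: "cube (Suc n) = double_graph (cube n)"
  by (cases n) (auto simp: double_graph_def path2_def)

lemma pverts_cube: "pverts (cube n) = {v. length v = n}"
  by (induction n) (auto simp: cube_Suc double_graph_def length_Suc_conv simp del: cube.simps(2,3))

lemma card_pverts_cube: "card (pverts (cube n)) = 2 ^ n"
  using card_lists_length_eq[of "UNIV :: bool set" n] by (simp add: pverts_cube)

lemma finite_pverts_cube: "finite (pverts (cube n))"
  using finite_lists_length_eq[of "UNIV :: bool set" n] by (simp add: pverts_cube)

lemma parcs_cube_subset: "parcs (cube n) \<subseteq> pverts (cube n) \<times> pverts (cube n)"
  by (induction n) (auto simp: cube_Suc double_graph_def simp del: cube.simps(2,3))

lemma pair_graph_cube: "pair_graph (cube n)"
proof
  show "finite (pverts (cube n))" by (rule finite_pverts_cube)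
  show "finite (parcs (cube n))"
    using finite_pverts_cube parcs_cube_subset by (meson finite_SigmaI finite_subset)
  show "symmetric (with_proj (cube n))"
    unfolding symmetric_def with_proj_simps
    by (induction n) (auto simp: cube_Suc double_graph_def sym_def simp del: cube.simps(2,3))
  show "fst e \<noteq> snd e" if "e \<in> parcs (cube n)" for e
    using that
    by (induction n arbitrary: e)
       (fastforce simp: cube_Suc double_graph_def simp del: cube.simps(2,3))+
qed (use parcs_cube_subset in force)+

lemma parcs_cube_nonempty: "n \<ge> 1 \<Longrightarrow> parcs (cube n) \<noteq> {}"
proof (induction n rule: dec_induct)
  case base
  then show ?case by (simp add: path2_def)
next
  case (step n)
  then show ?case by (fastforce simp: cube_Suc double_graph_def simp del: cube.simps(2,3))
qed

text \<open>The maximum defining \<^const>\<open>mc_nh\<close> is taken over a finite nonempty set.\<close>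

lemma finite_min_edge_weights:
  assumes "pair_graph G" "parcs G \<noteq> {}"
  shows "finite {min_edge_weight G \<psi> |\<psi>. no_hole_labeling N G \<psi>}"
proof (rule finite_subset)
  interpret pair_graph G by fact
  show "{min_edge_weight G \<psi> |\<psi>. no_hole_labeling N G \<psi>} \<subseteq> {..N}"
  proof clarify
    fix \<psi> assume lab: "no_hole_labeling N G \<psi>"
    have "min_edge_weight G \<psi> \<in> edge_weight \<psi> ` parcs G"
      unfolding min_edge_weight_def using assms(2) pair_finite_arcs by (intro Min_in) auto
    then obtain e where e: "e \<in> parcs G" "min_edge_weight G \<psi> = edge_weight \<psi> e" by auto
    have "\<psi> (fst e) \<in> {1..N}" "\<psi> (snd e) \<in> {1..N}"
      using lab e(1) arc_fst_in_verts arc_snd_in_verts unfolding no_hole_labeling_def by blast+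
    then show "min_edge_weight G \<psi> \<le> N"
      by (auto simp: e(2) edge_weight_def)
  qed
qed simp

lemma min_edge_weights_nonempty:
  assumes "finite (pverts G)" "card (pverts G) = N"
  shows "{min_edge_weight G \<psi> |\<psi>. no_hole_labeling N G \<psi>} \<noteq> {}"
proof -
  obtain \<psi> where "bij_betw \<psi> (pverts G) {1..N}"
    using assms finite_same_card_bij[of "pverts G" "{1..N}"] by auto
  then show ?thesis using assms by (auto simp: no_hole_labeling_iff_bij_betw)
qed

end

theory Submission
  imports Defs
begin

text \<open>
  Read a vertex of the \<open>n\<close>-cube as a bit string. The parity of its number of ones
  changes along every edge (\<open>odd_weight_flips_on_arc\<close>), so giving the labels up to
  \<open>2 ^ (n - 1)\<close> to the even vertices and the other labels to the odd ones already
  keeps adjacent vertices in different halves of the label range. A vertex is determined by its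
  parity together with its last \<open>n - 1\<close> bits, so within each half the labels can be
  given in the order of the number that has these bits as binary digits. Along an edge at most one
  of the \<open>n - 1\<close> digits changes, so this number changes by at most
  \<open>2 ^ (n - 2)\<close>, the weight of the leading digit
  (\<open>binary_value_change_on_arc\<close>), while the parity contributes
  \<open>2 ^ (n - 1)\<close>. Every edge therefore has weight at least
  \<open>2 ^ (n - 1) - 2 ^ (n - 2) = 2 ^ (n - 2)\<close>.
\<close>

abbreviation binary_value :: "bool list \<Rightarrow> nat" where
  "binary_value \<equiv> horner_sum of_bool 2"

definition odd_weight :: "bool list \<Rightarrow> bool" where
  "odd_weight v \<longleftrightarrow> odd (count_list v True)"

lemma odd_weight_Cons: "odd_weight (b # v) \<longleftrightarrow> b \<noteq> odd_weight v"
  by (auto simp: odd_weight_def)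

text \<open>The parity replaces the first bit, as the most significant digit.\<close>

definition parity_labeling :: "bool list \<Rightarrow> nat" where
  "parity_labeling v =
     1 + binary_value (tl v) + (if odd_weight v then 2 ^ length (tl v) else 0)"

lemma binary_value_less: "binary_value v < 2 ^ length v"
  by (induction v) auto

lemma Cons_Cons_in_parcs_cube_iff:
  "(b # u, c # v) \<in> parcs (cube (Suc n)) \<longleftrightarrow>
     b = c \<and> (u, v) \<in> parcs (cube n) \<or> b \<noteq> c \<and> u = v \<and> length u = n"
  by (auto simp: cube_Suc double_graph_def pverts_cube simp del: cube.simps(2,3))

lemma parcs_cube_length:
  assumes "(u, v) \<in> parcs (cube n)"
  shows "length u = n" "length v = n"
  using assms parcs_cube_subset[of n] by (auto simp: pverts_cube)

lemma parcs_cube_SucE: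
  assumes "(x, y) \<in> parcs (cube (Suc n))"
  obtains b u c v where "x = b # u" "y = c # v" "length u = n" "length v = n"
    "b = c \<and> (u, v) \<in> parcs (cube n) \<or> b \<noteq> c \<and> u = v"
  using parcs_cube_length[OF assms] assms
  by (auto simp: length_Suc_conv Cons_Cons_in_parcs_cube_iff simp del: cube.simps)

lemma odd_weight_flips_on_arc:
  assumes "(u, v) \<in> parcs (cube n)"
  shows "odd_weight u \<noteq> odd_weight v"
  using assms
proof (induction n arbitrary: u v)
  case (Suc n)
  from Suc.prems show ?case
    by (rule parcs_cube_SucE) (use Suc.IH in \<open>auto simp: odd_weight_Cons\<close>)
qed simp

text \<open>
  A single digit changes along an arc, and its weight is at most half of \<open>2 ^ n\<close>. The factor 2
  stands on the left to avoid \<open>2 ^ (n - 1)\<close> in the induction.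
\<close>

lemma binary_value_change_on_arc:
  assumes "(u, v) \<in> parcs (cube n)"
  shows "2 * \<bar>int (binary_value u) - int (binary_value v)\<bar> \<le> 2 ^ n"
  using assms
proof (induction n arbitrary: u v)
  case (Suc n)
  from Suc.prems show ?case
  proof (rule parcs_cube_SucE)
    fix b u' c v'
    assume eq: "u = b # u'" "v = c # v'"
      and arc: "b = c \<and> (u', v') \<in> parcs (cube n) \<or> b \<noteq> c \<and> u' = v'"
    from arc show ?thesis
    proof (elim disjE conjE)
      assume "b = c" "(u', v') \<in> parcs (cube n)"
      then show ?thesis using Suc.IH[of u' v'] by (simp add: eq) arith
    next
      assume "b \<noteq> c" "u' = v'"
      then have "\<bar>int (binary_value u) - int (binary_value v)\<bar> = 1"
        by (cases b; cases c) (simp_all add: eq)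
      then show ?thesis by simp
    qed
  qed
qed simp

lemma no_hole_parity_labeling:
  "no_hole_labeling (2 ^ Suc m) (cube (Suc m)) parity_labeling"
  unfolding no_hole_labeling_def
proof (intro equalityI subsetI)
  fix k assume "k \<in> parity_labeling ` pverts (cube (Suc m))"
  then obtain b u where "length u = m" "k = parity_labeling (b # u)"
    by (auto simp: pverts_cube length_Suc_conv simp del: cube.simps)
  then show "k \<in> {1..2 ^ Suc m}"
    using binary_value_less[of u] by (auto simp: parity_labeling_def)
next
  fix k :: nat assume k: "k \<in> {1..2 ^ Suc m}"
  define p where "p \<longleftrightarrow> k - 1 \<ge> 2 ^ m"
  define r where "r = k - 1 - (if p then 2 ^ m else 0)"
  \<comment> \<open>The binary digits of the remainder are the tail; the first bit then corrects the parity.\<close>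
  define u where "u = map (bit r) [0..<m]"
  have "r < 2 ^ m" using k by (auto simp: r_def p_def)
  then have val: "binary_value u = r"
    by (simp add: u_def horner_sum_bit_eq_take_bit take_bit_nat_eq_self)
  have len: "length u = m" by (simp add: u_def)
  let ?v = "(p \<noteq> odd_weight u) # u"
  have "k = 1 + r + (if p then 2 ^ m else 0)"
    using k by (auto simp: r_def p_def)
  then have "k = parity_labeling ?v"
    by (simp add: parity_labeling_def odd_weight_Cons val len)
  moreover have "?v \<in> pverts (cube (Suc m))"
    using len by (simp add: pverts_cube del: cube.simps)
  ultimately show "k \<in> parity_labeling ` pverts (cube (Suc m))" by blast
qed

lemma edge_weight_parity_labeling:
  assumes "e \<in> parcs (cube (Suc (Suc m)))"
  shows "2 ^ m \<le> edge_weight parity_labeling e"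
proof -
  obtain x y where e: "e = (x, y)" by (cases e)
  have flip: "odd_weight x \<noteq> odd_weight y"
    using assms odd_weight_flips_on_arc unfolding e by blast
  from assms obtain b u c v where xy: "x = b # u" "y = c # v"
    and len: "length u = Suc m" "length v = Suc m"
    and arc: "b = c \<and> (u, v) \<in> parcs (cube (Suc m)) \<or> b \<noteq> c \<and> u = v"
    unfolding e by (rule parcs_cube_SucE)
  from arc have "2 * \<bar>int (binary_value u) - int (binary_value v)\<bar> \<le> 2 ^ Suc m"
    using binary_value_change_on_arc[of u v "Suc m"] by auto
  then have close: "\<bar>int (binary_value u) - int (binary_value v)\<bar> \<le> 2 ^ m" by simp
  have "2 ^ m \<le> \<bar>int (parity_labeling x) - int (parity_labeling y)\<bar>"
    using flip close by (auto simp: parity_labeling_def xy len)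
  then show ?thesis by (simp add: e edge_weight_def le_nat_iff)
qed

theorem theorem18:
  fixes n :: nat
  assumes "n \<ge> 2"
  shows "mc_nh (2 ^ n) (cube n) \<ge> 2 ^ (n - 2)"
proof -
  interpret pair_graph "cube n" by (rule pair_graph_cube)
  obtain m where n: "n = Suc (Suc m)"
    using assms by (metis add_2_eq_Suc le_Suc_ex)
  have nonempty: "parcs (cube n) \<noteq> {}"
    using assms by (intro parcs_cube_nonempty) simp
  have "2 ^ (n - 2) \<le> min_edge_weight (cube n) parity_labeling"
    unfolding min_edge_weight_def
    using nonempty pair_finite_arcs edge_weight_parity_labeling[of _ m]
    by (auto simp: n simp del: cube.simps)
  also have "\<dots> \<le> mc_nh (2 ^ n) (cube n)"
    unfolding mc_nh_def
    using no_hole_parity_labeling[of "Suc m"]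
    by (intro Max_ge finite_min_edge_weights pair_graph_cube nonempty)
       (auto simp: n simp del: cube.simps)
  finally show ?thesis .
qed

end
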